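(* Let $d\ge1$ and let $\{P_n\}_{n\ge0}$ be a Hahn-classical $d$-orthogonal polynomial sequence, with $Q_n=P_{n+1}'/(n+1)$, $n\ge0$. Then: (1) There exist an integer $1\le r\le d+1$ and complex numbers $a_{n,k}$ such that, for all $n$, $$P_n(x)=Q_n(x)+\sum_{i=1}^{r}a_{n,i}Q_{n-i}(x).$$ (2) There exist a polynomial $\pi_l$ of degree $l\le d+1$, an integer $\rho\le d^2-1$ and complex numbers $a_{n,v}$ such that, for all $n$, $$\pi_l(x)Q_n(x)=\sum_{v=n-\rho}^{n+l}a_{n,v}P_v(x).$$
   Context: All polynomial sequences are monic with complex coefficients, $\deg P_n=n$; polynomials with negative index are $0$. A monic sequence $\{P_n\}_{n\ge0}$ is a $d$-orthogonal polynomial sequence ($d$-OPS) with respect to a vector of linear forms $\mathcal U=(u_0,\dots,u_{d-1})^T$ on complex polynomials if, for each $0\le t\le d-1$ and all $m\ge0$: $\langle u_t,x^mP_n\rangle=0$ for $n\ge md+t+1$ and $\langle u_t,x^mP_{md+t}\rangle\ne0$. It is called Hahn-classical if it is a $d$-OPS and the normalized derivative sequence $\{Q_n=P_{n+1}'/(n+1)\}_{n\ge0}$ is also a $d$-OPS (with respect to some vector of linear forms). *)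

theory Defs
  imports Complex_Main "HOL-Computational_Algebra.Polynomial"
begin

definition monic_seq :: "(nat \<Rightarrow> complex poly) \<Rightarrow> bool" where
  "monic_seq P \<longleftrightarrow> (\<forall>n. degree (P n) = n \<and> lead_coeff (P n) = 1)"

abbreviation linear_form :: "(complex poly \<Rightarrow> complex) \<Rightarrow> bool" where
  "linear_form \<equiv> Vector_Spaces.linear smult (*)"

text \<open>A vector of linear forms is a family \<open>u\<close> indexed by \<open>nat\<close>;
  only the entries \<open>u t\<close> with \<open>t < d\<close> are relevant.\<close>

definition d_OPS :: "nat \<Rightarrow> (nat \<Rightarrow> complex poly \<Rightarrow> complex) \<Rightarrow> (nat \<Rightarrow> complex poly) \<Rightarrow> bool" where
  "d_OPS d u P \<longleftrightarrow> monic_seq P \<and> (\<forall>t<d. linear_form (u t)) \<and>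
     (\<forall>t<d. \<forall>m. (\<forall>n\<ge>m * d + t + 1. u t (monom 1 m * P n) = 0) \<and>
                 u t (monom 1 m * P (m * d + t)) \<noteq> 0)"

definition normalized_deriv :: "(nat \<Rightarrow> complex poly) \<Rightarrow> nat \<Rightarrow> complex poly" where
  "normalized_deriv P n = smult (1 / of_nat (n + 1)) (pderiv (P (n + 1)))"

definition Hahn_classical :: "nat \<Rightarrow> (nat \<Rightarrow> complex poly) \<Rightarrow> bool" where
  "Hahn_classical d P \<longleftrightarrow> (\<exists>u. d_OPS d u P) \<and> (\<exists>v. d_OPS d v (normalized_deriv P))"

text \<open>Extension of a sequence to integer indices, with value 0 at negative indices.\<close>

definition int_seq :: "(nat \<Rightarrow> complex poly) \<Rightarrow> int \<Rightarrow> complex poly" where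
  "int_seq P k = (if k < 0 then 0 else P (nat k))"

end

(*
  Differentiating the recurrence of P_n gives (1), since the products x Q_n are again short
  combinations of the Q_m. Hence every form v_t of Q kills P_n for n > t + d + 1, so
  v_t = sum_s B_ts u_s with polynomial coefficients such that d * deg B_ts + s <= t + d + 1.
  Take pi = det B: it is nonzero because the v_t are independent over the polynomials, and
  weighing rows and columns bounds its degree by d + 1. The adjugate C of B satisfies
  pi u_s = sum_t C_st v_t with d * deg C_st + t <= s + d^2 - 1, which makes the coefficients
  of pi Q_n at P_v vanish for v < n - (d^2 - 1).
*)

theory Submission
  imports "Jordan_Normal_Form.Determinant" Defs
begin

section \<open>Monic sequences and linear forms\<close>

lemma linear_form_add: "linear_form u \<Longrightarrow> u (f + g) = u f + u g"
  using module_hom.add module_hom_iff_linear by blast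

lemma linear_form_smult: "linear_form u \<Longrightarrow> u (smult c f) = c * u f"
  using module_hom.scale module_hom_iff_linear by blast

lemma linear_form_0: "linear_form u \<Longrightarrow> u 0 = 0"
  using linear_form_smult[of u 0 0] by simp

lemma linear_form_sum: "linear_form u \<Longrightarrow> u (sum f A) = (\<Sum>x\<in>A. u (f x))"
  by (induction A rule: infinite_finite_induct) (auto simp: linear_form_0 linear_form_add)

lemma linear_formI:
  assumes "\<And>f g. u (f + g) = u f + u g" "\<And>c f. u (smult c f) = c * u f"
  shows "linear_form u"
  unfolding Vector_Spaces.linear_def module_hom_def module_hom_axioms_def
    Modules.module_def vector_space_def
  using assms by (auto simp: algebra_simps smult_add_left smult_add_right)

text \<open>Subtracting \<open>coeff f n\<close> times \<open>P n\<close> removes the top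
  coefficient. The bound is on coefficients rather than on \<open>degree f < n\<close> so that the
  induction can start at \<open>n = 0\<close>, where it forces \<open>f = 0\<close>.\<close>

lemma monic_seq_expansion:
  assumes "monic_seq P" "\<And>i. i \<ge> n \<Longrightarrow> coeff f i = 0"
  shows "\<exists>a. f = (\<Sum>v<n. smult (a v) (P v))"
  using assms(2)
proof (induction n arbitrary: f)
  case 0
  then have "f = 0" by (intro poly_eqI) simp
  then show ?case by simp
next
  case (Suc n)
  let ?g = "f - smult (coeff f n) (P n)"
  have P: "degree (P n) = n" "coeff (P n) n = 1"
    using assms(1) unfolding monic_seq_def by metis+
  have "coeff ?g i = 0" if "i \<ge> n" for i
    using that P Suc.prems[of i] coeff_eq_0[of "P n" i] by (cases "i = n") auto
  from Suc.IH[OF this] obtain a where a: "?g = (\<Sum>v<n. smult (a v) (P v))" by blast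
  then have "f = (\<Sum>v<n. smult (a v) (P v)) + smult (coeff f n) (P n)"
    by (simp add: algebra_simps)
  then show ?case
    by (intro exI[of _ "\<lambda>v. if v = n then coeff f n else a v"]) simp
qed

lemma linear_form_eq_0:
  assumes "monic_seq P" "linear_form w" "\<And>n. w (P n) = 0"
  shows "w f = 0"
proof -
  obtain a where "f = (\<Sum>v<Suc (degree f). smult (a v) (P v))"
    using monic_seq_expansion[OF assms(1), of "Suc (degree f)" f] by (force simp: coeff_eq_0)
  then have "w f = w (\<Sum>v<Suc (degree f). smult (a v) (P v))" by simp
  also have "\<dots> = 0"
    using assms by (simp only: linear_form_sum linear_form_smult) simp
  finally show ?thesis .
qed

section \<open>Consequences of d-orthogonality\<close>

context
  fixes d u P
  assumes OPS: "d_OPS d u P" and d: "d \<ge> 1"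
begin

lemma d_OPS_monic: "monic_seq P"
  and d_OPS_linear: "t < d \<Longrightarrow> linear_form (u t)"
  and d_OPS_vanish: "t < d \<Longrightarrow> m * d + t < n \<Longrightarrow> u t (monom 1 m * P n) = 0"
  and d_OPS_regular: "t < d \<Longrightarrow> u t (monom 1 m * P (m * d + t)) \<noteq> 0"
  using OPS unfolding d_OPS_def by auto

text \<open>Orthogonality against an arbitrary multiplier: the monomials of \<open>f\<close> below
  the top one meet the strict bound of \<open>d_OPS_vanish\<close>, so only the leading monomial can
  contribute, and only at equality.\<close>

lemma d_OPS_poly:
  assumes t: "t < d" and f: "degree f * d + t \<le> n"
  shows "u t (f * P n) = (if n = degree f * d + t
            then lead_coeff f * u t (monom 1 (degree f) * P n) else 0)"
proof -
  have "u t (f * P n) = u t ((\<Sum>i\<le>degree f. monom (coeff f i) i) * P n)"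
    by (simp add: poly_as_sum_of_monoms)
  also have "\<dots> = (\<Sum>i\<le>degree f. u t (smult (coeff f i) (monom 1 i * P n)))"
    using d_OPS_linear[OF t] by (simp add: sum_distrib_right linear_form_sum smult_monom flip: mult_smult_left)
  also have "\<dots> = (\<Sum>i\<le>degree f. coeff f i * u t (monom 1 i * P n))"
    using d_OPS_linear[OF t] by (simp add: linear_form_smult)
  also have "\<dots> = (\<Sum>i<degree f. coeff f i * u t (monom 1 i * P n))
      + lead_coeff f * u t (monom 1 (degree f) * P n)"
    by (simp flip: lessThan_Suc_atMost)
  also have "(\<Sum>i<degree f. coeff f i * u t (monom 1 i * P n)) = 0"
  proof (intro sum.neutral ballI)
    fix i assume "i \<in> {..<degree f}"
    then have "i * d < degree f * d" using d by simp
    then have "i * d + t < n" using f by linarith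
    then show "coeff f i * u t (monom 1 i * P n) = 0" using d_OPS_vanish[OF t] by simp
  qed
  finally show ?thesis using f d_OPS_vanish[OF t, of "degree f" n] by auto
qed

text \<open>The numbers \<open>j * d + s\<close> with \<open>s < d\<close> run through each natural
  number once. Testing the expansion of \<open>f\<close> against the forms \<open>u s\<close>
  multiplied by x^j thus gives a triangular system with nonzero diagonal, and vanishing tests below
  \<open>K\<close> remove the coefficients below \<open>K\<close>.\<close>

lemma d_OPS_expansion_from_below:
  assumes f: "degree f \<le> m"
    and K: "\<And>s j. s < d \<Longrightarrow> j * d + s < K \<Longrightarrow> u s (monom 1 j * f) = 0"
  shows "\<exists>a. f = (\<Sum>v=K..m. smult (a v) (P v))"
proof -
  obtain a where a: "f = (\<Sum>v<Suc m. smult (a v) (P v))"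
    using monic_seq_expansion[OF d_OPS_monic, of "Suc m" f] f by (force simp: coeff_eq_0)
  have a0: "v < K \<longrightarrow> v \<le> m \<longrightarrow> a v = 0" for v
  proof (induction v rule: less_induct)
    case (less v)
    show ?case
    proof (intro impI)
      assume v: "v < K" "v \<le> m"
      \<comment> \<open>This is the one test whose pairing with \<open>P v\<close> is
        regular.\<close>
      define j s where "j = v div d" and "s = v mod d"
      have js: "v = j * d + s" "s < d" using d by (auto simp: j_def s_def)
      have "0 = u s (monom 1 j * f)" using K js v by auto
      also have "monom 1 j * f = (\<Sum>w<Suc m. smult (a w) (monom 1 j * P w))"
        by (subst a) (simp only: sum_distrib_left mult_smult_right)
      also have "u s \<dots> = (\<Sum>w<Suc m. a w * u s (monom 1 j * P w))"
        using d_OPS_linear[OF js(2)] by (simp only: linear_form_sum linear_form_smult)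
      also have "\<dots> = (\<Sum>w\<in>{v}. a w * u s (monom 1 j * P w))"
      proof (rule sum.mono_neutral_right)
        show "\<forall>w\<in>{..<Suc m} - {v}. a w * u s (monom 1 j * P w) = 0"
        proof
          \<comment> \<open>Below \<open>v\<close> the coefficient is zero by induction; above
            \<open>v\<close> the pairing is zero by orthogonality.\<close>
          fix w assume "w \<in> {..<Suc m} - {v}"
          then consider "w < v" | "w > v" by fastforce
          then show "a w * u s (monom 1 j * P w) = 0"
            using less.IH[of w] v d_OPS_vanish[OF js(2), of j w] js(1) by cases auto
        qed
      qed (use v in auto)
      finally show "a v = 0" using d_OPS_regular[OF js(2), of j] js(1) by simp
    qed
  qed
  have "f = (\<Sum>v<Suc m. smult (a v) (P v))" by (fact a)
  also have "\<dots> = (\<Sum>v=K..m. smult (a v) (P v))"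
    using a0 by (intro sum.mono_neutral_right) force+
  finally show ?thesis by blast
qed

text \<open>Multiplication by x turns the test x^j into x^(j+1), which shifts the index
  \<open>j * d + s\<close> by \<open>d\<close>; hence the lower end \<open>n - d\<close>.\<close>

lemma d_OPS_recurrence:
  "\<exists>a. [:0, 1:] * P n = (\<Sum>v=n - d..Suc n. smult (a v) (P v))"
proof (rule d_OPS_expansion_from_below)
  have "degree (P n) = n" using d_OPS_monic unfolding monic_seq_def by blast
  then show "degree ([:0, 1:] * P n) \<le> Suc n" 
    using degree_mult_le[of "[:0, 1:]" "P n"] by simp
next
  fix s j assume "s < d" "j * d + s < n - d"
  then have "u s (monom 1 (Suc j) * P n) = 0"
    using d_OPS_vanish[of s "Suc j" n] by simp
  then show "u s (monom 1 j * ([:0, 1:] * P n)) = 0"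
    by (simp add: monom_Suc mult_ac)
qed

text \<open>Induction on \<open>N\<close> peels off the last nonzero value: one monomial multiple of
  a single \<open>u s\<close> matches \<open>w\<close> at \<open>P N\<close> and vanishes at all
  later \<open>P n\<close>. The weight \<open>degree (f t) * d + t\<close> records the last index at
  which a summand can be nonzero.\<close>

lemma d_OPS_represent:
  assumes "linear_form w" "\<And>n. n \<ge> N \<Longrightarrow> w (P n) = 0"
  shows "\<exists>f. (\<forall>t<d. f t = 0 \<or> degree (f t) * d + t < N) \<and> (\<forall>g. w g = (\<Sum>t<d. u t (f t * g)))"
  using assms
proof (induction N arbitrary: w)
  case 0
  then have "w g = 0" for g using linear_form_eq_0[OF d_OPS_monic] by blast
  then show ?case by (intro exI[of _ "\<lambda>_. 0"]) (simp add: linear_form_0[OF d_OPS_linear])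
next
  case (Suc N)
  define j s where "j = N div d" and "s = N mod d"
  have js: "N = j * d + s" "s < d" using d by (auto simp: j_def s_def)
  \<comment> \<open>Chosen so that \<open>w'\<close> vanishes at \<open>P N\<close>; the denominator
    is nonzero by regularity.\<close>
  define c where "c = w (P N) / u s (monom 1 j * P N)"
  define w' where "w' g = w g - u s (monom c j * g)" for g
  note lin = d_OPS_linear[OF js(2)]
  have c_eq: "u s (monom c j * g) = c * u s (monom 1 j * g)" for g
    using linear_form_smult[OF lin, of c "monom 1 j * g"] by (simp add: smult_monom flip: mult_smult_left)
  have w': "linear_form w'"
    unfolding w'_def c_eq
    by (rule linear_formI)
      (simp_all add: linear_form_add[OF Suc.prems(1)] linear_form_add[OF lin] distrib_left
        linear_form_smult[OF Suc.prems(1)] linear_form_smult[OF lin] algebra_simps)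
  have "w' (P n) = 0" if "n \<ge> N" for n
  proof (cases "n = N")
    case True
    then show ?thesis using d_OPS_regular[OF js(2), of j] js(1)
      unfolding True w'_def c_eq by (simp add: c_def)
  next
    case False
    then show ?thesis using that d_OPS_vanish[OF js(2), of j n] js(1) Suc.prems(2)[of n]
      by (simp add: w'_def c_eq)
  qed
  from Suc.IH[OF w' this] obtain f where
    f: "\<And>t. t < d \<Longrightarrow> f t = 0 \<or> degree (f t) * d + t < N" "\<And>g. w' g = (\<Sum>t<d. u t (f t * g))"
    by blast
  define h where "h = f(s := f s + monom c j)"
  have "h t = 0 \<or> degree (h t) * d + t < Suc N" if "t < d" for t
  proof (cases "t = s")
    case True
    \<comment> \<open>The weight of \<open>f s\<close> is below \<open>N = j * d + s\<close>, so
      adding the new monomial cannot push the degree past \<open>j\<close>.\<close>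
    have "f s = 0 \<or> degree (f s) \<le> j"
    proof (rule disjCI)
      assume "\<not> degree (f s) \<le> j"
      then have "j * d < degree (f s) * d" using d by simp
      then show "f s = 0" using f(1)[OF js(2)] js(1) by auto
    qed
    then have "degree (f s + monom c j) \<le> j"
      by (auto intro!: degree_add_le degree_monom_le)
    then have "degree (f s + monom c j) * d \<le> j * d" by (rule mult_le_mono1)
    then have "degree (f s + monom c j) * d + s < Suc N" using js(1) by linarith
    then show ?thesis using True by (simp add: h_def)
  qed (use f(1)[OF that] in \<open>auto simp: h_def\<close>)
  moreover have "w g = (\<Sum>t<d. u t (h t * g))" for g
  proof -
    have "(\<Sum>t<d. u t (h t * g)) = (\<Sum>t<d. u t (f t * g) + (if t = s then u s (monom c j * g) else 0))"
      by (intro sum.cong) (auto simp: h_def distrib_right linear_form_add[OF lin])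
    also have "\<dots> = w' g + u s (monom c j * g)"
      using js(2) by (simp add: sum.distrib f(2))
    finally show ?thesis by (simp add: w'_def)
  qed
  ultimately show ?case by blast
qed

text \<open>Among the \<open>f t\<close>, the one maximising \<open>degree (f t) * d + t\<close> is unique, because the
  residue mod \<open>d\<close> recovers \<open>t\<close>; the form is then nonzero at the \<open>P n\<close> with this index.\<close>

lemma d_OPS_independent:
  assumes "\<And>g. (\<Sum>t<d. u t (f t * g)) = 0" "t < d"
  shows "f t = 0"
proof (rule ccontr)
  assume ft: "f t \<noteq> 0"
  define T where "T = {t. t < d \<and> f t \<noteq> 0}"
  define wt where "wt t = degree (f t) * d + t" for t
  have T: "finite T" "T \<noteq> {}" using ft assms(2) by (auto simp: T_def)
  have "Max (wt ` T) \<in> wt ` T" using T by (intro Max_in) auto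
  then obtain s where s: "s \<in> T" "Max (wt ` T) = wt s" by blast
  then have max: "wt t \<le> wt s" if "t \<in> T" for t using Max_ge[of "wt ` T" "wt t"] that T by auto
  have sd: "s < d" "f s \<noteq> 0" using s(1) by (auto simp: T_def)
  have "0 = (\<Sum>t<d. u t (f t * P (wt s)))" using assms(1) by simp
  also have "\<dots> = (\<Sum>t\<in>{s}. u t (f t * P (wt s)))"
  proof (rule sum.mono_neutral_right)
    show "\<forall>t\<in>{..<d} - {s}. u t (f t * P (wt s)) = 0"
    proof
      fix t assume t: "t \<in> {..<d} - {s}"
      show "u t (f t * P (wt s)) = 0"
      proof (cases "f t = 0")
        case True
        then show ?thesis using t by (simp add: linear_form_0[OF d_OPS_linear])
      next
        case False
        have "wt t mod d = t" "wt s mod d = s" using t sd by (auto simp: wt_def)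
        then have "wt s \<noteq> wt t" using t by auto
        then show ?thesis using d_OPS_poly[of t "f t" "wt s"] max[of t] t False
          by (simp add: T_def wt_def)
      qed
    qed
  qed (use sd in auto)
  also have "\<dots> = lead_coeff (f s) * u s (monom 1 (degree (f s)) * P (wt s))"
    using d_OPS_poly[of s "f s" "wt s"] sd by (simp add: wt_def)
  finally show False using d_OPS_regular[OF sd(1), of "degree (f s)"] sd(2) by (simp add: wt_def)
qed

end

section \<open>Weighted degrees of determinants\<close>

text \<open>Each Leibniz product takes one entry from every row and every column, so the row bounds
  add up to the total of \<open>w\<close> while the column weights add up to that of
  \<open>c\<close>. Zero is a separate case because its degree is 0 by convention.\<close>

lemma det_weighted_degree:
  fixes A :: "complex poly mat"
  assumes A: "A \<in> carrier_mat n n"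
    and wt: "\<And>i j. i < n \<Longrightarrow> j < n \<Longrightarrow> A $$ (i, j) = 0 \<or> degree (A $$ (i, j)) * d + c j \<le> w i"
  shows "det A = 0 \<or> degree (det A) * d + (\<Sum>j<n. c j) \<le> (\<Sum>i<n. w i)"
proof -
  let ?ok = "\<lambda>f :: complex poly. f = 0 \<or> degree f * d + (\<Sum>j<n. c j) \<le> (\<Sum>i<n. w i)"
  \<comment> \<open>The admissible polynomials are closed under sums, so the individual Leibniz
    terms suffice.\<close>
  have add: "?ok (f + g)" if "?ok f" "?ok g" for f g
  proof (cases "f = 0 \<or> g = 0")
    case False
    have "degree (f + g) * d \<le> max (degree f) (degree g) * d"
      by (intro mult_le_mono1 degree_add_le_max)
    also have "\<dots> = max (degree f * d) (degree g * d)"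
      by (simp add: max_def)
    finally show ?thesis using that False by linarith
  qed (use that in auto)
  have sum: "?ok (sum F S)" if "\<And>x. x \<in> S \<Longrightarrow> ?ok (F x)" for F :: "(nat \<Rightarrow> nat) \<Rightarrow> complex poly" and S
    using that
  proof (induction S rule: infinite_finite_induct)
    case (insert x S)
    have "?ok (F x + sum F S)" by (intro add insert) auto
    then show ?case using insert.hyps by simp
  qed auto
  have "?ok (signof p * (\<Prod>i=0..<n. A $$ (i, p i)))" if "p permutes {0..<n}" for p
  proof (cases "\<exists>i<n. A $$ (i, p i) = 0")
    case True
    then have "(\<Prod>i=0..<n. A $$ (i, p i)) = 0" by force
    then show ?thesis by simp
  next
    case False
    have p: "p i < n" if "i < n" for i using \<open>p permutes _\<close> that permutes_in_image by fastforce
    \<comment> \<open>The sign is 1 or -1 and leaves the degree unchanged.\<close>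
    have deg: "degree (signof p * (\<Prod>i=0..<n. A $$ (i, p i))) = degree (\<Prod>i=0..<n. A $$ (i, p i))"
      by (simp add: sign_def)
    also have "\<dots> \<le> (\<Sum>i<n. degree (A $$ (i, p i)))"
      using degree_prod_sum_le[of "{0..<n}" "\<lambda>i. A $$ (i, p i)"] by (simp add: atLeast0LessThan)
    finally have "degree (signof p * (\<Prod>i=0..<n. A $$ (i, p i))) * d
        \<le> (\<Sum>i<n. degree (A $$ (i, p i)) * d)"
      unfolding sum_distrib_right[symmetric] by (rule mult_le_mono1)
    moreover have "(\<Sum>j<n. c j) = (\<Sum>i<n. c (p i))"
      using sum.permute[OF that, of c] by (simp add: atLeast0LessThan)
    moreover have "(\<Sum>i<n. degree (A $$ (i, p i)) * d) + (\<Sum>i<n. c (p i)) \<le> (\<Sum>i<n. w i)"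
      unfolding sum.distrib[symmetric] using wt p False by (intro sum_mono) fastforce
    ultimately show ?thesis by linarith
  qed
  then show ?thesis unfolding det_def'[OF A] by (intro sum) auto
qed

text \<open>\<open>insert_index s\<close> enumerates the indices other than \<open>s\<close>:
  deleting a row or column takes exactly its own weight off the total.\<close>

lemma sum_insert_index:
  assumes "s < n"
  shows "(\<Sum>i<n - 1. c (insert_index s i)) + c s = (\<Sum>i<n. c i :: nat)"
proof -
  have "insert_index s ` {..<n - 1} = {..<n} - {s}"
  proof (intro equalityI subsetI)
    fix x assume "x \<in> {..<n} - {s}"
    then have "x = insert_index s (delete_index s x)" "delete_index s x < n - 1"
      using assms by (auto simp: insert_delete_index delete_index_def)
    then show "x \<in> insert_index s ` {..<n - 1}" by blast
  qed (use assms in \<open>auto simp: insert_index_def split: if_splits\<close>)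
  then have "(\<Sum>i<n - 1. c (insert_index s i)) = (\<Sum>i\<in>{..<n} - {s}. c i)"
    using sum.reindex[OF insert_index_inj_on[of s], of c "{..<n - 1}"] by simp
  then show ?thesis using assms sum.remove[of "{..<n}" s c] by simp
qed

text \<open>Up to sign the entry is the minor without row \<open>t\<close> and column
  \<open>s\<close>, so the totals lose \<open>w t\<close> and \<open>c s\<close>. Both are moved
  across the inequality to avoid subtraction of naturals.\<close>

lemma adj_mat_weighted_degree:
  fixes A :: "complex poly mat"
  assumes A: "A \<in> carrier_mat n n" and st: "s < n" "t < n"
    and wt: "\<And>i j. i < n \<Longrightarrow> j < n \<Longrightarrow> A $$ (i, j) = 0 \<or> degree (A $$ (i, j)) * d + c j \<le> w i"
  shows "adj_mat A $$ (s, t) = 0 \<or>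
    degree (adj_mat A $$ (s, t)) * d + w t + (\<Sum>j<n. c j) \<le> c s + (\<Sum>i<n. w i)"
proof -
  let ?M = "mat_delete A t s"
  have M: "?M $$ (i, j) = A $$ (insert_index t i, insert_index s j)" if "i < n - 1" "j < n - 1" for i j
    using that mat_delete_index[of A "n - 1" t s i j] A st by auto
  have "det ?M = 0 \<or> degree (det ?M) * d + (\<Sum>j<n - 1. c (insert_index s j))
      \<le> (\<Sum>i<n - 1. w (insert_index t i))"
  proof (rule det_weighted_degree[OF mat_delete_carrier[OF A]])
    fix i j assume ij: "i < n - 1" "j < n - 1"
    then have "insert_index t i < n" "insert_index s j < n" by (auto simp: insert_index_def)
    then show "?M $$ (i, j) = 0 \<or>
        degree (?M $$ (i, j)) * d + c (insert_index s j) \<le> w (insert_index t i)"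
      using wt M ij by auto
  qed
  then have *: "det ?M = 0 \<or> degree (det ?M) * d + w t + (\<Sum>j<n. c j) \<le> c s + (\<Sum>i<n. w i)"
    using sum_insert_index[OF st(1), of c] sum_insert_index[OF st(2), of w] by linarith
  have "adj_mat A $$ (s, t) = det ?M \<or> adj_mat A $$ (s, t) = - det ?M"
    using A st by (auto simp: adj_mat_def cofactor_def minus_one_power_iff)
  then show ?thesis using * by auto
qed

lemma pderiv_sum: "pderiv (sum f A) = (\<Sum>x\<in>A. pderiv (f x))"
  by (induction A rule: infinite_finite_induct) (auto simp: pderiv_add)

section \<open>Structure relations\<close>


lemma pderiv_eq_normalized_deriv: "pderiv (P (Suc n)) = smult (of_nat (Suc n)) (normalized_deriv P n)"
  unfolding normalized_deriv_def by (simp del: of_nat_Suc)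

text \<open>By the product rule \<open>P n\<close> is the derivative of x \<open>P n\<close> minus x
  times the derivative of \<open>P n\<close>. Each of the two is killed by the tests of the
  derivative sequence with index below \<open>n - (d + 1)\<close>.\<close>

lemma first_structure_relation:
  assumes d: "d \<ge> 1" and P: "d_OPS d u P" and Q: "d_OPS d v (normalized_deriv P)"
  shows "\<exists>a. P n = (\<Sum>m=n - (d + 1)..n. smult (a m) (normalized_deriv P m))"
proof (rule d_OPS_expansion_from_below[OF Q d])
  have monic: "monic_seq P" using d_OPS_monic[OF P d] .
  show "degree (P n) \<le> n" using monic by (simp add: monic_seq_def)
  fix s j assume sj: "s < d" "j * d + s < n - (d + 1)"
  define Q where "Q = normalized_deriv P"
  note lin = d_OPS_linear[OF Q d sj(1)] and van = d_OPS_vanish[OF Q d sj(1), folded Q_def]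
  obtain k where k: "n = Suc k" using sj(2) by (cases n) auto
  obtain a where a: "[:0, 1:] * P n = (\<Sum>v=n - d..Suc n. smult (a v) (P v))"
    using d_OPS_recurrence[OF P d] by blast
  have "P n + [:0, 1:] * pderiv (P n) = pderiv ([:0, 1:] * P n)"
    by (simp add: pderiv_mult pderiv_pCons)
  also have "\<dots> = (\<Sum>v=n - d..Suc n. smult (a v) (pderiv (P v)))"
    by (simp only: a pderiv_sum pderiv_smult)
  finally have eq: "P n = (\<Sum>v=n - d..Suc n. smult (a v) (pderiv (P v))) - [:0, 1:] * pderiv (P n)"
    by (simp add: algebra_simps)
  have "v s (monom 1 j * pderiv (P m)) = 0" if m: "m \<in> {n - d..Suc n}" for m
  proof -
    \<comment> \<open>The test exists only if \<open>n > d + 1\<close>, so \<open>m\<close> is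
      positive and \<open>pderiv (P m)\<close> is a multiple of \<open>Q m'\<close> with
      \<open>m' >= n - d - 1\<close>.\<close>
    obtain m' where m': "m = Suc m'" using m sj(2) by (cases m) auto
    have "j * d + s < m'" using m sj(2) unfolding m' by simp linarith
    then show ?thesis
      using van[of j m'] unfolding m' pderiv_eq_normalized_deriv Q_def[symmetric]
      by (simp add: linear_form_smult[OF lin] del: of_nat_Suc)
  qed
  then have 1: "v s (monom 1 j * (\<Sum>v=n - d..Suc n. smult (a v) (pderiv (P v)))) = 0"
    by (simp add: sum_distrib_left linear_form_sum[OF lin] linear_form_smult[OF lin] del: sum.cl_ivl_Suc)
  \<comment> \<open>The extra factor x costs \<open>d\<close> and differentiation costs 1, which is
    exactly the gap \<open>d + 1\<close>.\<close>
  have "v s (monom 1 (Suc j) * Q k) = 0"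
    using van[of "Suc j" k] sj(2) k by simp
  moreover have "monom 1 j * ([:0, 1:] * pderiv (P n)) = smult (of_nat n) (monom 1 (Suc j) * Q k)"
    unfolding k pderiv_eq_normalized_deriv Q_def[symmetric]
    by (simp add: monom_Suc mult_ac del: of_nat_Suc)
  ultimately have 2: "v s (monom 1 j * ([:0, 1:] * pderiv (P n))) = 0"
    by (simp only: linear_form_smult[OF lin] mult_zero_right)
  have "monom 1 j * P n + monom 1 j * ([:0, 1:] * pderiv (P n))
      = monom 1 j * (\<Sum>v=n - d..Suc n. smult (a v) (pderiv (P v)))"
    by (subst eq) (simp only: right_diff_distrib diff_add_cancel)
  then show "v s (monom 1 j * P n) = 0"
    using linear_form_add[OF lin] 1 2 by (metis add.right_neutral)
qed

lemma second_structure_relation: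
  assumes d: "d \<ge> 1" and P: "d_OPS d u P" and Q: "d_OPS d v Q"
    and PQ: "\<And>n. \<exists>a. P n = (\<Sum>m=n - (d + 1)..n. smult (a m) (Q m))"
  shows "\<exists>\<pi>. \<pi> \<noteq> 0 \<and> degree \<pi> \<le> d + 1 \<and>
    (\<forall>n. \<exists>a. \<pi> * Q n = (\<Sum>m=n + 1 - d\<^sup>2..n + degree \<pi>. smult (a m) (P m)))"
proof -
  \<comment> \<open>For \<open>n >= t + d + 2\<close> the expansion \<open>PQ\<close> involves only
    \<open>Q m\<close> with \<open>m > t\<close>, all killed by \<open>v t\<close>.\<close>
  have "\<exists>f. (\<forall>s<d. f s = 0 \<or> degree (f s) * d + s < t + d + 2) \<and>
      (\<forall>g. v t g = (\<Sum>s<d. u s (f s * g)))" if t: "t < d" for t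
  proof (rule d_OPS_represent[OF P d])
    show lin: "linear_form (v t)" using d_OPS_linear[OF Q d t] .
    fix n assume n: "n \<ge> t + d + 2"
    obtain a where "P n = (\<Sum>m=n - (d + 1)..n. smult (a m) (Q m))" using PQ by blast
    then have "v t (P n) = (\<Sum>m=n - (d + 1)..n. a m * v t (Q m))"
      by (simp only: linear_form_sum[OF lin] linear_form_smult[OF lin])
    also have "\<dots> = 0"
      using d_OPS_vanish[OF Q d t, of 0] n by (intro sum.neutral) auto
    finally show "v t (P n) = 0" .
  qed
  then obtain B where
    B_deg: "\<And>t s. t < d \<Longrightarrow> s < d \<Longrightarrow> B t s = 0 \<or> degree (B t s) * d + s < t + d + 2" and
    B: "\<And>t g. t < d \<Longrightarrow> v t g = (\<Sum>s<d. u s (B t s * g))"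
    by metis
  define A where "A = mat d d (\<lambda>(t, s). B t s)"
  have A: "A \<in> carrier_mat d d" by (simp add: A_def)
  define \<pi> where "\<pi> = det A"
  define C where "C s t = adj_mat A $$ (s, t)" for s t
  \<comment> \<open>Row weight \<open>t + (d + 1)\<close>, column weight \<open>s\<close>; the
    totals differ by \<open>d * (d + 1)\<close>.\<close>
  have A_deg: "A $$ (t, s) = 0 \<or> degree (A $$ (t, s)) * d + s \<le> t + (d + 1)"
    if "t < d" "s < d" for t s
    using B_deg[OF that] that by (auto simp: A_def)
  have sum_w: "(\<Sum>t<d. t + (d + 1)) = (\<Sum>t<d. t) + d * (d + 1)"
    by (simp only: sum.distrib sum_constant card_lessThan of_nat_id distrib_left)
  have \<pi>0: "\<pi> \<noteq> 0"
  proof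
    assume "\<pi> = 0"
    then have "det (transpose_mat A) = 0" using det_transpose[OF A] by (simp add: \<pi>_def)
    \<comment> \<open>A singular matrix over the polynomials has a nonzero polynomial vector in its
      left kernel, and this would be a polynomial dependence between the \<open>v t\<close>.\<close>
    then obtain w where w: "w \<in> carrier_vec d" "w \<noteq> 0\<^sub>v d" "transpose_mat A *\<^sub>v w = 0\<^sub>v d"
      using det_0_iff_vec_prod_zero[of "transpose_mat A" d] A by auto
    have wB: "(\<Sum>t<d. w $ t * B t s) = 0" if "s < d" for s
    proof -
      have "0 = (transpose_mat A *\<^sub>v w) $ s" using w(3) that by simp
      also have "\<dots> = (\<Sum>t<d. B t s * w $ t)"
        using w(1) that by (simp add: A_def scalar_prod_def atLeast0LessThan)
      finally show ?thesis by (simp add: mult.commute)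
    qed
    have "(\<Sum>t<d. v t (w $ t * g)) = 0" for g
    proof -
      have "(\<Sum>t<d. v t (w $ t * g)) = (\<Sum>t<d. \<Sum>s<d. u s (w $ t * B t s * g))"
        by (simp add: B mult_ac)
      also have "\<dots> = (\<Sum>s<d. \<Sum>t<d. u s (w $ t * B t s * g))" by (rule sum.swap)
      also have "\<dots> = (\<Sum>s<d. u s ((\<Sum>t<d. w $ t * B t s) * g))"
        by (simp add: linear_form_sum[OF d_OPS_linear[OF P d]] sum_distrib_right)
      also have "\<dots> = 0" by (simp add: wB linear_form_0[OF d_OPS_linear[OF P d]])
      finally show ?thesis .
    qed
    then have "w $ t = 0" if "t < d" for t using d_OPS_independent[OF Q d] that by blast
    then have "w = 0\<^sub>v d" using w(1) by (intro eq_vecI) auto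
    then show False using w(2) by contradiction
  qed
  have "degree \<pi> * d \<le> d * (d + 1)"
    using det_weighted_degree[OF A A_deg] \<pi>0 sum_w unfolding \<pi>_def by simp
  then have "d * degree \<pi> \<le> d * (d + 1)" by (simp only: mult.commute)
  then have \<pi>_deg: "degree \<pi> \<le> d + 1" using d unfolding mult_le_cancel1 by simp
  \<comment> \<open>The column total cancels, and \<open>d * (d + 1)\<close> less the weight
    \<open>d + 1\<close> of the deleted row leaves \<open>d^2 - 1\<close>.\<close>
  have C_deg: "C s t = 0 \<or> degree (C s t) * d + t + 1 \<le> s + d\<^sup>2" if "s < d" "t < d" for s t
  proof -
    have "C s t = 0 \<or> degree (C s t) * d + (t + (d + 1)) + (\<Sum>j<d. j) \<le> s + ((\<Sum>j<d. j) + d * (d + 1))"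
      unfolding C_def sum_w[symmetric]
      by (rule adj_mat_weighted_degree[OF A that, where w = "\<lambda>i. i + (d + 1)"]) (rule A_deg)
    moreover have "d * (d + 1) = d\<^sup>2 + d" by (simp add: power2_eq_square)
    ultimately show ?thesis by linarith
  qed
  have CB: "(\<Sum>t<d. C s t * B t s') = (if s = s' then \<pi> else 0)" if "s < d" "s' < d" for s s'
  proof -
    have "(\<Sum>t<d. C s t * B t s') = (adj_mat A * A) $$ (s, s')"
      using adj_mat(1)[OF A] A that
      by (simp add: scalar_prod_def atLeast0LessThan C_def) (simp add: A_def)
    then show ?thesis using adj_mat(3)[OF A] that by (simp add: \<pi>_def)
  qed
  \<comment> \<open>Inverts the system \<open>B\<close> up to the factor \<open>\<pi>\<close>, by
    the adjugate identity \<open>CB\<close>.\<close>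
  have \<pi>u: "u s (\<pi> * g) = (\<Sum>t<d. v t (C s t * g))" if s: "s < d" for s g
  proof -
    have "(\<Sum>t<d. v t (C s t * g)) = (\<Sum>t<d. \<Sum>s'<d. u s' (C s t * B t s' * g))"
      by (simp add: B mult_ac)
    also have "\<dots> = (\<Sum>s'<d. \<Sum>t<d. u s' (C s t * B t s' * g))" by (rule sum.swap)
    also have "\<dots> = (\<Sum>s'<d. u s' ((\<Sum>t<d. C s t * B t s') * g))"
      by (simp add: linear_form_sum[OF d_OPS_linear[OF P d]] sum_distrib_right)
    also have "\<dots> = (\<Sum>s'<d. if s = s' then u s (\<pi> * g) else 0)"
      using s by (intro sum.cong) (auto simp: CB linear_form_0[OF d_OPS_linear[OF P d]])
    finally show ?thesis using s by simp
  qed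
  have "\<exists>a. \<pi> * Q n = (\<Sum>m=n + 1 - d\<^sup>2..n + degree \<pi>. smult (a m) (P m))" for n
  proof (rule d_OPS_expansion_from_below[OF P d])
    have "degree (Q n) = n" using d_OPS_monic[OF Q d] unfolding monic_seq_def by blast
    then show "degree (\<pi> * Q n) \<le> n + degree \<pi>" using degree_mult_le[of \<pi> "Q n"] by simp
    fix s j assume s: "s < d" and j: "j * d + s < n + 1 - d\<^sup>2"
    have "u s (monom 1 j * (\<pi> * Q n)) = (\<Sum>t<d. v t ((C s t * monom 1 j) * Q n))"
      using \<pi>u[OF s, of "monom 1 j * Q n"] by (simp add: mult_ac)
    also have "\<dots> = 0"
    proof (intro sum.neutral ballI)
      fix t assume "t \<in> {..<d}"
      then have t: "t < d" by simp
      show "v t ((C s t * monom 1 j) * Q n) = 0"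
      proof (cases "C s t = 0")
        case True
        then show ?thesis by (simp add: linear_form_0[OF d_OPS_linear[OF Q d t]])
      next
        case False
        then have "degree (C s t * monom 1 j) = degree (C s t) + j"
          by (subst degree_mult_eq) (simp_all add: degree_monom_eq)
        \<comment> \<open>\<open>C_deg\<close> and the bound on \<open>j * d + s\<close> give strict
          inequality, the zero branch of \<open>d_OPS_poly\<close>.\<close>
        then have "degree (C s t * monom 1 j) * d + t < n"
          using C_deg[OF s t] False j by (simp add: distrib_right)
        then show ?thesis using d_OPS_poly[OF Q d t, of "C s t * monom 1 j" n] by simp
      qed
    qed
    finally show "u s (monom 1 j * (\<pi> * Q n)) = 0" .
  qed
  then show ?thesis using \<pi>0 \<pi>_deg by blast
qed

section \<open>Both relations rewritten with integer indices\<close>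

theorem corollary7p5:
  fixes d :: nat and P Q :: "nat \<Rightarrow> complex poly"
  assumes "d \<ge> 1"
    and "Hahn_classical d P"
    and "Q = normalized_deriv P"
  shows "(\<exists>(r::nat) (a :: nat \<Rightarrow> nat \<Rightarrow> complex). 1 \<le> r \<and> r \<le> d + 1 \<and>
            (\<forall>n. P n = Q n + (\<Sum>i=1..r. smult (a n i) (int_seq Q (int n - int i))))) \<and>
         (\<exists>(\<pi> :: complex poly) (l::nat) (\<rho>::int) (a :: nat \<Rightarrow> int \<Rightarrow> complex).
            \<pi> \<noteq> 0 \<and> degree \<pi> = l \<and> l \<le> d + 1 \<and> \<rho> \<le> (int d)\<^sup>2 - 1 \<and>
            (\<forall>n. \<pi> * Q n = (\<Sum>v=int n - \<rho>..int n + int l. smult (a n v) (int_seq P v))))"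
proof -
  obtain u v where P: "d_OPS d u P" and Q: "d_OPS d v Q"
    using assms(2,3) unfolding Hahn_classical_def by blast
  have PQ: "\<exists>a. P n = (\<Sum>m=n - (d + 1)..n. smult (a m) (Q m))" for n
    using first_structure_relation[OF assms(1) P] Q assms(3) by blast
  then obtain a where a: "\<And>n. P n = (\<Sum>m=n - (d + 1)..n. smult (a n m) (Q m))" by metis
  obtain \<pi> where \<pi>: "\<pi> \<noteq> 0" "degree \<pi> \<le> d + 1"
      "\<And>n. \<exists>a. \<pi> * Q n = (\<Sum>m=n + 1 - d\<^sup>2..n + degree \<pi>. smult (a m) (P m))"
    using second_structure_relation[OF assms(1) P Q PQ] by metis
  obtain b where b: "\<And>n. \<pi> * Q n = (\<Sum>m=n + 1 - d\<^sup>2..n + degree \<pi>. smult (b n m) (P m))"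
    using \<pi>(3) by metis
  have degs: "degree (P n) = n" "coeff (P n) n = 1" "degree (Q n) = n" "coeff (Q n) n = 1" for n
    using d_OPS_monic[OF P assms(1)] d_OPS_monic[OF Q assms(1)] unfolding monic_seq_def by metis+
  \<comment> \<open>Substitution \<open>m = n - i\<close>. For \<open>i > n\<close> the truncated
    \<open>n - i\<close> is harmless, since \<open>int_seq\<close> is 0 there.\<close>
  have 1: "P n = Q n + (\<Sum>i=1..d + 1. smult (a n (n - i)) (int_seq Q (int n - int i)))" for n
  proof -
    have "P n = (\<Sum>m\<in>insert n {n - (d + 1)..<n}. smult (a n m) (Q m))"
      by (subst a) (intro sum.cong, auto)
    then have split: "P n = smult (a n n) (Q n) + (\<Sum>m=n - (d + 1)..<n. smult (a n m) (Q m))"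
      by simp
    \<comment> \<open>Comparing the coefficients of x^n gives \<open>a n n = 1\<close>.\<close>
    have "1 = coeff (smult (a n n) (Q n) + (\<Sum>m=n - (d + 1)..<n. smult (a n m) (Q m))) n"
      using degs(2)[of n] split by simp
    also have "\<dots> = a n n"
      using degs by (simp add: coeff_sum coeff_eq_0)
    finally have "a n n = 1" by simp
    moreover have "(\<Sum>m=n - (d + 1)..<n. smult (a n m) (Q m))
        = (\<Sum>i\<in>{i\<in>{1..d + 1}. i \<le> n}. smult (a n (n - i)) (int_seq Q (int n - int i)))"
      by (rule sum.reindex_bij_witness[of _ "\<lambda>i. n - i" "\<lambda>m. n - m"])
        (auto simp: int_seq_def nat_diff_distrib')
    moreover have "\<dots> = (\<Sum>i=1..d + 1. smult (a n (n - i)) (int_seq Q (int n - int i)))"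
      by (rule sum.mono_neutral_left) (auto simp: int_seq_def)
    ultimately show ?thesis using split by simp
  qed
  have 2: "\<pi> * Q n = (\<Sum>v=int n - ((int d)\<^sup>2 - 1)..int n + int (degree \<pi>).
      smult (b n (nat v)) (int_seq P v))" for n
  proof -
    have "\<pi> * Q n = (\<Sum>v\<in>int ` {n + 1 - d\<^sup>2..n + degree \<pi>}. smult (b n (nat v)) (int_seq P v))"
      by (subst sum.reindex) (auto simp: b int_seq_def)
    also have "\<dots> = (\<Sum>v=int n - ((int d)\<^sup>2 - 1)..int n + int (degree \<pi>).
      smult (b n (nat v)) (int_seq P v))"
    proof (rule sum.mono_neutral_left)
      define D where "D = d\<^sup>2"
      have sq: "(int d)\<^sup>2 = int D" by (simp add: D_def)
      show "int ` {n + 1 - d\<^sup>2..n + degree \<pi>}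
          \<subseteq> {int n - ((int d)\<^sup>2 - 1)..int n + int (degree \<pi>)}"
        unfolding sq D_def[symmetric] by auto
      show "\<forall>v\<in>{int n - ((int d)\<^sup>2 - 1)..int n + int (degree \<pi>)} - int ` {n + 1 - d\<^sup>2..n + degree \<pi>}.
          smult (b n (nat v)) (int_seq P v) = 0"
      proof
        fix v assume v: "v \<in> {int n - ((int d)\<^sup>2 - 1)..int n + int (degree \<pi>)}
            - int ` {n + 1 - d\<^sup>2..n + degree \<pi>}"
        \<comment> \<open>Truncation of \<open>n + 1 - d\<^sup>2\<close> drops only negative
          indices, where \<open>int_seq\<close> vanishes.\<close>
        have "v < 0"
        proof (rule ccontr)
          assume "\<not> v < 0"
          then have "nat v \<in> {n + 1 - d\<^sup>2..n + degree \<pi>}" "v = int (nat v)"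
            using v unfolding sq D_def[symmetric] by auto
          then show False using v by blast
        qed
        then show "smult (b n (nat v)) (int_seq P v) = 0" by (simp add: int_seq_def)
      qed
    qed simp
    finally show ?thesis .
  qed
  show ?thesis
  proof (intro conjI)
    show "\<exists>(r::nat) (a :: nat \<Rightarrow> nat \<Rightarrow> complex). 1 \<le> r \<and> r \<le> d + 1 \<and>
        (\<forall>n. P n = Q n + (\<Sum>i=1..r. smult (a n i) (int_seq Q (int n - int i))))"
      using 1 by (intro exI[of _ "d + 1"] exI[of _ "\<lambda>n i. a n (n - i)"]) simp
    show "\<exists>(\<pi> :: complex poly) (l::nat) (\<rho>::int) (a :: nat \<Rightarrow> int \<Rightarrow> complex).
        \<pi> \<noteq> 0 \<and> degree \<pi> = l \<and> l \<le> d + 1 \<and> \<rho> \<le> (int d)\<^sup>2 - 1 \<and>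
        (\<forall>n. \<pi> * Q n = (\<Sum>v=int n - \<rho>..int n + int l. smult (a n v) (int_seq P v)))"
      \<comment> \<open>The largest permitted value \<open>d^2 - 1\<close> serves as
        \<open>\<rho>\<close>.\<close>
      using 2 \<pi>(1,2)
      by (intro exI[of _ \<pi>] exI[of _ "degree \<pi>"] exI[of _ "(int d)\<^sup>2 - 1"]
          exI[of _ "\<lambda>n v. b n (nat v)"]) simp
  qed
qed

end
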